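(* For every $p\in[0,1]$, let $\rho_p=p\,|\psi\rangle\langle\psi|+(1-p)\,|\phi\rangle\langle\phi|$. The optimal CHSH value attainable on two copies of $\rho_p$ is the same as on one copy, and $$V_1(p)=V_2(p)=2\sqrt{1+(1-2p)^2},$$ where $V_n(p)$ denotes the largest CHSH value attainable by $\pm1$-valued observables on $\rho_p^{\otimes n}$.
   Context: Bell states: $|\psi\rangle=\frac1{\sqrt2}(|00\rangle+|11\rangle)$ and $|\phi\rangle=\frac1{\sqrt2}(|01\rangle+|10\rangle)$ in $\mathbb C^2\otimes\mathbb C^2$, the first qubit held by Alice and the second by Bob. In $n$ copies, Alice holds the $n$ first qubits and Bob the $n$ second qubits, so that $\rho_p^{\otimes n}$ is regarded as a state on $(\mathbb C^2)^{\otimes n}\otimes(\mathbb C^2)^{\otimes n}$ (Alice $\otimes$ Bob). A $\pm1$-valued observable on $(\mathbb C^2)^{\otimes n}$ is a Hermitian operator $A$ with $A^2=\mathbb 1$. The optimal CHSH value on $n$ copies is $$V_n(p)=\sup_{A_0,A_1,B_0,B_1}\operatorname{Tr}\Bigl[\bigl(A_0\otimes B_0+A_0\otimes B_1+A_1\otimes B_0-A_1\otimes B_1\bigr)\rho_p^{\otimes n}\Bigr],$$ the supremum being over $\pm1$-valued observables $A_0,A_1$ on Alice's $n$ qubits and $B_0,B_1$ on Bob's $n$ qubits. *)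

theory Defs
  imports "HOL-Analysis.Analysis"
begin

text \<open>
  Spaces are \<open>complex ^ 'i\<close> for a finite type \<open>'i\<close> of labels of the
  computational basis. A qubit uses the two-element type \<open>2\<close>, whose elements are \<open>0\<close> and \<open>1\<close>
  (the numeral \<open>2\<close> of that type equals \<open>0\<close>). A tensor product of two spaces is indexed by pairs of
  labels. The tensor power \<open>(C^2)^{\<otimes>n}\<close> is indexed by the bit strings \<open>'n \<Rightarrow> 2\<close>, the finite type \<open>'n\<close> with
  \<open>n\<close> elements numbering the copies.
\<close>

definition ket :: "'i::finite \<Rightarrow> complex ^ 'i" where
  "ket i = axis i 1"

definition tensor_vec :: "complex ^ 'a::finite \<Rightarrow> complex ^ 'b::finite \<Rightarrow> complex ^ ('a \<times> 'b)"
    (infixl "\<otimes>\<^sub>v" 70) where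
  "u \<otimes>\<^sub>v v = (\<chi> i. u $ fst i * v $ snd i)"

definition tensor_mat ::
    "complex ^ 'a::finite ^ 'a \<Rightarrow> complex ^ 'b::finite ^ 'b \<Rightarrow> complex ^ ('a \<times> 'b) ^ ('a \<times> 'b)"
    (infixl "\<otimes>" 70) where
  "A \<otimes> B = (\<chi> i j. A $ fst i $ fst j * B $ snd i $ snd j)"

definition tensor_power :: "complex ^ 'a::finite ^ 'a \<Rightarrow> complex ^ ('n::finite \<Rightarrow> 'a) ^ ('n \<Rightarrow> 'a)" where
  "tensor_power A = (\<chi> i j. \<Prod>k\<in>UNIV. A $ i k $ j k)"

text \<open>The identification of \<open>(H \<otimes> K)^{\<otimes>n}\<close> with \<open>H^{\<otimes>n} \<otimes> K^{\<otimes>n}\<close>, on operators.\<close>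

definition regroup ::
    "complex ^ ('n::finite \<Rightarrow> 'a::finite \<times> 'b::finite) ^ ('n \<Rightarrow> 'a \<times> 'b)
      \<Rightarrow> complex ^ (('n \<Rightarrow> 'a) \<times> ('n \<Rightarrow> 'b)) ^ (('n \<Rightarrow> 'a) \<times> ('n \<Rightarrow> 'b))" where
  "regroup M = (\<chi> i j. M $ (\<lambda>k. (fst i k, snd i k)) $ (\<lambda>k. (fst j k, snd j k)))"

definition ket_bra :: "complex ^ 'i::finite \<Rightarrow> complex ^ 'i ^ 'i" where
  "ket_bra v = (\<chi> i j. v $ i * cnj (v $ j))"

definition hermitian_adjoint :: "complex ^ 'i::finite ^ 'i \<Rightarrow> complex ^ 'i ^ 'i" where
  "hermitian_adjoint A = map_matrix cnj (transpose A)"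

definition observable :: "complex ^ 'i::finite ^ 'i \<Rightarrow> bool" where
  "observable A \<longleftrightarrow> hermitian_adjoint A = A \<and> A ** A = mat 1"

definition bell_psi :: "complex ^ (2 \<times> 2)" where
  "bell_psi = (1 / sqrt 2) *\<^sub>R (ket 0 \<otimes>\<^sub>v ket 0 + ket 1 \<otimes>\<^sub>v ket 1)"

definition bell_phi :: "complex ^ (2 \<times> 2)" where
  "bell_phi = (1 / sqrt 2) *\<^sub>R (ket 0 \<otimes>\<^sub>v ket 1 + ket 1 \<otimes>\<^sub>v ket 0)"

definition rho :: "real \<Rightarrow> complex ^ (2 \<times> 2) ^ (2 \<times> 2)" where
  "rho p = p *\<^sub>R ket_bra bell_psi + (1 - p) *\<^sub>R ket_bra bell_phi"

definition chsh_operator ::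
    "complex ^ 'a::finite ^ 'a \<Rightarrow> complex ^ 'a ^ 'a \<Rightarrow> complex ^ 'b::finite ^ 'b \<Rightarrow> complex ^ 'b ^ 'b
      \<Rightarrow> complex ^ ('a \<times> 'b) ^ ('a \<times> 'b)" where
  "chsh_operator A0 A1 B0 B1 = A0 \<otimes> B0 + A0 \<otimes> B1 + A1 \<otimes> B0 - A1 \<otimes> B1"

text \<open>
  The value \<open>V_n(p)\<close> with \<open>n = CARD('n)\<close>. The trace is real, being that of a product of two Hermitian
  operators, so \<open>Re\<close> only changes its type; the set is nonempty and bounded.
\<close>

definition chsh_value :: "'n::finite itself \<Rightarrow> real \<Rightarrow> real" where
  "chsh_value _ p =
    Sup {Re (trace (chsh_operator A0 A1 B0 B1 ** regroup (tensor_power (rho p)))) |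
           (A0 :: complex ^ ('n \<Rightarrow> 2) ^ ('n \<Rightarrow> 2)) (A1 :: complex ^ ('n \<Rightarrow> 2) ^ ('n \<Rightarrow> 2))
           (B0 :: complex ^ ('n \<Rightarrow> 2) ^ ('n \<Rightarrow> 2)) (B1 :: complex ^ ('n \<Rightarrow> 2) ^ ('n \<Rightarrow> 2)).
           observable A0 \<and> observable A1 \<and> observable B0 \<and> observable B1}"

end

theory Submission
  imports Defs
begin

text \<open>
  Conjugating every qubit by the Hadamard matrix turns \<open>\<rho>\<^sub>p\<^sup>\<otimes>\<^sup>n\<close> into
  \<open>2\<^sup>-\<^sup>n \<Sum>\<^sub>x\<^sub>y K\<^sub>x\<^sub>y |x x><y y|\<close> with \<open>K\<^sub>x\<^sub>y = s\<^sup>d\<close>, where \<open>s = 2p - 1\<close> and \<open>d\<close> is the Hamming distance of \<open>x\<close>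
  and \<open>y\<close>. A correlation is thus the average over \<open>x\<close> of \<open>\<Sum>\<^sub>y K\<^sub>x\<^sub>y A\<^sub>y\<^sub>x B\<^sub>y\<^sub>x\<close>. For fixed \<open>x\<close> the columns of the
  observables are unit vectors whose entry at \<open>x\<close> is real, and \<open>K\<close> is \<open>1\<close> at \<open>y = x\<close> and at most \<open>|s|\<close>
  elsewhere, so Horodecki's two-qubit argument, with \<open>1\<close> and \<open>|s|\<close> as the two largest singular values of the
  correlation matrix, bounds each column's contribution by \<open>2 \<surd>(1 + s\<^sup>2)\<close>. This works for any number of
  copies. Pauli observables on a single copy attain the bound.
\<close>

section \<open>Bound for a single column\<close>

lemma sum_Horodecki_le:
  fixes u0 u1 v0 v1 :: "complex ^ 'm::finite" and k :: "'m \<Rightarrow> real"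
  assumes unit: "norm u0 = 1" "norm u1 = 1" "norm v0 = 1" "norm v1 = 1"
    and real: "Im (v0 $ x) = 0" "Im (v1 $ x) = 0"
    and k: "k x = 1" "\<And>y. y \<noteq> x \<Longrightarrow> \<bar>k y\<bar> \<le> \<bar>s\<bar>" and s: "\<bar>s\<bar> \<le> 1"
  shows "(\<Sum>y\<in>UNIV. k y * (u0 $ y \<bullet> (v0 + v1) $ y + u1 $ y \<bullet> (v0 - v1) $ y)) \<le> 2 * sqrt (1 + s\<^sup>2)"
proof -
  define K where "K w = (\<chi> y. k y *\<^sub>R w $ y)" for w :: "complex ^ 'm"
  define c where "c = v0 + v1"
  define d where "d = v0 - v1"
  \<comment> \<open>Equal norms of \<open>v0\<close> and \<open>v1\<close> give orthogonality, and
    the parallelogram law gives 4. The inner product here is the real one, the real part of the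
    Hermitian one.\<close>
  have orth: "c \<bullet> d = 0" and CD: "(norm c)\<^sup>2 + (norm d)\<^sup>2 = 4"
    using unit by (simp_all add: c_def d_def power2_norm_eq_inner algebra_simps inner_commute norm_eq_1)
  have s2: "s\<^sup>2 \<le> 1" using s by (simp add: abs_square_le_1)
  \<comment> \<open>\<open>K\<close> keeps the entry at \<open>x\<close> and shrinks each other
    entry by a factor of at most \<open>\<bar>s\<bar>\<close>.\<close>
  have K: "(norm (K w))\<^sup>2 \<le> s\<^sup>2 * (norm w)\<^sup>2 + (1 - s\<^sup>2) * (norm (w $ x))\<^sup>2" for w
  proof -
    have n: "(norm v)\<^sup>2 = (norm (v $ x))\<^sup>2 + (\<Sum>y\<in>UNIV-{x}. (norm (v $ y))\<^sup>2)" for v :: "complex ^ 'm"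
      by (simp add: norm_vec_def L2_set_def sum_nonneg sum.remove[of UNIV x])
    have "(\<Sum>y\<in>UNIV-{x}. (norm (K w $ y))\<^sup>2) \<le> (\<Sum>y\<in>UNIV-{x}. s\<^sup>2 * (norm (w $ y))\<^sup>2)"
      using k(2) by (intro sum_mono) (auto simp: K_def power_mult_distrib abs_le_square_iff intro!: mult_right_mono)
    then show ?thesis
      unfolding n[of w] n[of "K w"] by (simp add: K_def k(1) sum_distrib_left algebra_simps)
  qed
  have K1: "norm (K w) \<le> norm w" for w
  proof -
    have "norm (w $ x) \<le> norm w" by (rule Finite_Cartesian_Product.norm_nth_le)
    then have "(norm (w $ x))\<^sup>2 \<le> (norm w)\<^sup>2" by (simp add: power_mono)
    then have "(1 - s\<^sup>2) * (norm (w $ x))\<^sup>2 \<le> (1 - s\<^sup>2) * (norm w)\<^sup>2"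
      using s2 by (intro mult_left_mono) auto
    with K[of w] have "(norm (K w))\<^sup>2 \<le> (norm w)\<^sup>2" by (simp only: left_diff_distrib)
    then show ?thesis by (rule power2_le_imp_le) simp
  qed
  have "norm (K c) + norm (K d) \<le> 2 * sqrt (1 + s\<^sup>2)"
  proof (cases "c = 0 \<or> d = 0")
    \<comment> \<open>If one of \<open>c\<close>, \<open>d\<close> vanishes, the other has norm 2;
      the general case divides by both norms.\<close>
    case True
    have "1 \<le> sqrt (1 + s\<^sup>2)" by simp
    moreover have "norm c + norm d = 2"
      using True CD by (auto simp: power2_eq_iff_nonneg[of _ 2, simplified])
    ultimately show ?thesis using K1[of c] K1[of d] by linarith
  next
    case False
    define C where "C = norm c"
    define D where "D = norm d"
    have pos: "C > 0" "D > 0" using False by (auto simp: C_def D_def)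
    \<comment> \<open>\<open>\<gamma>\<close> and \<open>\<delta>\<close> are the shares of the
      squared norms of \<open>c\<close> and \<open>d\<close> carried by the entry at
      \<open>x\<close>.\<close>
    define \<gamma> where "\<gamma> = (norm (c $ x))\<^sup>2 / C\<^sup>2"
    define \<delta> where "\<delta> = (norm (d $ x))\<^sup>2 / D\<^sup>2"
    have "\<gamma> + \<delta> \<le> 1"
    proof -
      \<comment> \<open>Bessel's inequality for the basis vector at \<open>x\<close> and the orthogonal vectors \<open>c\<close>, \<open>d\<close>;
        its real inner products with them are their entries at \<open>x\<close> because those are real.\<close>
      define e where "e = (axis x 1 :: complex ^ 'm)"
      have ec: "e \<bullet> c = Re (c $ x)" "e \<bullet> d = Re (d $ x)" "e \<bullet> e = 1"
        by (simp_all add: e_def inner_axis' inner_complex_def)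
      have nx: "(norm (c $ x))\<^sup>2 = (e \<bullet> c)\<^sup>2" "(norm (d $ x))\<^sup>2 = (e \<bullet> d)\<^sup>2"
        unfolding ec using real by (auto simp: cmod_power2 c_def d_def)
      define a where "a = (e \<bullet> c) / C\<^sup>2"
      define b where "b = (e \<bullet> d) / D\<^sup>2"
      have sq: "c \<bullet> c = C\<^sup>2" "d \<bullet> d = D\<^sup>2" by (simp_all add: C_def D_def dot_square_norm)
      define w where "w = e - a *\<^sub>R c - b *\<^sub>R d"
      have ac: "a * C\<^sup>2 = e \<bullet> c" and bd: "b * D\<^sup>2 = e \<bullet> d"
        using pos by (simp_all add: a_def b_def)
      have "w \<bullet> w = 1 - 2 * (a * (e \<bullet> c)) - 2 * (b * (e \<bullet> d)) + a * (a * C\<^sup>2) + b * (b * D\<^sup>2)"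
        by (simp add: w_def inner_diff_left inner_diff_right ec(3) inner_commute[of c e] inner_commute[of d e]
            inner_commute[of d c] orth sq algebra_simps)
      also have "\<dots> = 1 - a * (e \<bullet> c) - b * (e \<bullet> d)"
        unfolding ac bd by simp
      also have "\<dots> = 1 - (e \<bullet> c)\<^sup>2 / C\<^sup>2 - (e \<bullet> d)\<^sup>2 / D\<^sup>2"
        by (simp add: a_def b_def power2_eq_square)
      finally have "w \<bullet> w = 1 - (e \<bullet> c)\<^sup>2 / C\<^sup>2 - (e \<bullet> d)\<^sup>2 / D\<^sup>2" .
      moreover have "0 \<le> w \<bullet> w" by simp
      ultimately show ?thesis by (simp add: \<gamma>_def \<delta>_def nx)
    qed
    \<comment> \<open>\<open>g\<close> and \<open>h\<close> bound the squared stretching factors of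
      \<open>K\<close> on \<open>c\<close> and \<open>d\<close>. Since the shares add up to at most
      1, \<open>g + h\<close> is at most \<open>2 s^2 + (1 - s^2)\<close>.\<close>
    define g where "g = s\<^sup>2 + (1 - s\<^sup>2) * \<gamma>"
    define h where "h = s\<^sup>2 + (1 - s\<^sup>2) * \<delta>"
    have gh0: "0 \<le> g" "0 \<le> h" using s2 by (auto simp: g_def h_def \<gamma>_def \<delta>_def)
    have "(1 - s\<^sup>2) * (\<gamma> + \<delta>) \<le> 1 - s\<^sup>2"
      using \<open>\<gamma> + \<delta> \<le> 1\<close> s2 by (simp add: mult_left_le)
    then have gh: "g + h \<le> 1 + s\<^sup>2" by (simp add: g_def h_def algebra_simps)
    have "(norm (K c))\<^sup>2 \<le> C\<^sup>2 * g" "(norm (K d))\<^sup>2 \<le> D\<^sup>2 * h"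
    proof -
      have "C\<^sup>2 * g = s\<^sup>2 * C\<^sup>2 + (1 - s\<^sup>2) * (C\<^sup>2 * \<gamma>)" "D\<^sup>2 * h = s\<^sup>2 * D\<^sup>2 + (1 - s\<^sup>2) * (D\<^sup>2 * \<delta>)"
        by (simp_all add: g_def h_def algebra_simps)
      moreover have "C\<^sup>2 * \<gamma> = (norm (c $ x))\<^sup>2" "D\<^sup>2 * \<delta> = (norm (d $ x))\<^sup>2"
        using pos by (simp_all add: \<gamma>_def \<delta>_def)
      ultimately show "(norm (K c))\<^sup>2 \<le> C\<^sup>2 * g" "(norm (K d))\<^sup>2 \<le> D\<^sup>2 * h"
        using K[of c] K[of d] by (simp_all only: C_def D_def)
    qed
    moreover have "n \<le> m * sqrt t" if "n\<^sup>2 \<le> m\<^sup>2 * t" "m > 0" "t \<ge> 0" for n m t :: real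
      by (rule power2_le_imp_le) (use that in \<open>simp_all add: power_mult_distrib\<close>)
    ultimately have "norm (K c) \<le> C * sqrt g" "norm (K d) \<le> D * sqrt h"
      using pos gh0 by blast+
    then have "norm (K c) + norm (K d) \<le> (C, D) \<bullet> (sqrt g, sqrt h)" by simp
    \<comment> \<open>Cauchy-Schwarz in the plane, where \<open>(C, D)\<close> has norm 2 by
      \<open>CD\<close>.\<close>
    also have "\<dots> \<le> norm (C, D) * norm (sqrt g, sqrt h)" by (rule norm_cauchy_schwarz)
    also have "\<dots> = 2 * sqrt (g + h)"
      using CD gh0 by (simp add: norm_Pair C_def D_def)
    also have "\<dots> \<le> 2 * sqrt (1 + s\<^sup>2)" using gh by simp
    finally show ?thesis .
  qed
  moreover have "(\<Sum>y\<in>UNIV. k y * (u0 $ y \<bullet> c $ y + u1 $ y \<bullet> d $ y)) = u0 \<bullet> K c + u1 \<bullet> K d"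
    by (simp add: inner_vec_def K_def sum.distrib algebra_simps)
  \<comment> \<open>Once the real weights sit on \<open>c\<close> and \<open>d\<close>,
    Cauchy-Schwarz eliminates Alice's unit vectors.\<close>
  moreover have "u0 \<bullet> K c \<le> norm (K c)" "u1 \<bullet> K d \<le> norm (K d)"
    using norm_cauchy_schwarz[of u0 "K c"] norm_cauchy_schwarz[of u1 "K d"] unit by auto
  ultimately show ?thesis unfolding c_def d_def by linarith
qed

section \<open>Tensor powers and the state in the Hadamard basis\<close>

lemma prod_sum_fun:
  fixes f :: "'n::finite \<Rightarrow> 'a::finite \<Rightarrow> 'b::comm_semiring_1"
  shows "(\<Prod>k\<in>UNIV. \<Sum>a\<in>UNIV. f k a) = (\<Sum>g\<in>UNIV. \<Prod>k\<in>UNIV. f k (g k))"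
  using prod_sum_PiE[of "UNIV :: 'n set" "\<lambda>_. UNIV :: 'a set" f] by (simp add: PiE_UNIV_domain)

lemma tensor_power_mult: "tensor_power A ** tensor_power B = tensor_power (A ** B)"
  by (simp add: vec_eq_iff tensor_power_def matrix_matrix_mult_def prod_sum_fun prod.distrib)

lemma tensor_power_mat_1: "tensor_power (mat 1) = mat 1"
  by (auto simp: vec_eq_iff tensor_power_def mat_def fun_eq_iff)

definition hadamard :: "complex ^ 2 ^ 2" where
  "hadamard = (\<chi> i j. (if i = 1 \<and> j = 1 then -1 else 1) / sqrt 2)"

lemma sum_UNIV_2: "(\<Sum>i\<in>(UNIV :: 2 set). f i) = f 0 + f 1"
proof -
  have "(2 :: 2) = 0" by simp
  then show ?thesis by (simp only: sum_2 add.commute)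
qed

lemma cases_2: "i = 0 \<or> i = (1 :: 2)"
  using exhaust_2[of i] by auto

lemma hadamard_involution: "hadamard ** hadamard = mat 1"
proof -
  have "complex_of_real (sqrt 2) * complex_of_real (sqrt 2) = 2"
    by (simp flip: of_real_mult)
  moreover have "(hadamard ** hadamard) $ i $ j = mat 1 $ i $ j" for i j
    using cases_2[of i] cases_2[of j]
    by (elim disjE) (simp_all add: hadamard_def matrix_matrix_mult_def sum_UNIV_2 mat_def calculation)
  ultimately show ?thesis by (simp add: vec_eq_iff)
qed

lemma hadamard_sym: "hadamard $ i $ j = hadamard $ j $ i"
  by (simp add: hadamard_def conj_commute)

lemma hadamard_real: "cnj (hadamard $ i $ j) = hadamard $ i $ j"
  by (simp add: hadamard_def)

text \<open>This is \<open>s\<close> to the power of the Hamming distance, written as a product so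
  that it factors over the copies.\<close>

definition dephasing :: "real \<Rightarrow> ('n::finite \<Rightarrow> 2) \<Rightarrow> ('n \<Rightarrow> 2) \<Rightarrow> real" where
  "dephasing s x y = (\<Prod>k\<in>UNIV. if x k = y k then 1 else s)"

text \<open>In the Hadamard basis, \<open>bell_psi\<close> and \<open>bell_phi\<close> are the
  normalized sum and difference of |++> and |-->. Mixing them leaves weight 1/2 on the two diagonal
  terms and \<open>(2 * p - 1) / 2\<close> on the two cross terms.\<close>

lemma rho_hadamard:
  "rho p $ (a, b) $ (c, d) =
    (\<Sum>x\<in>UNIV. \<Sum>y\<in>UNIV. complex_of_real (if x = y then 1 else 2 * p - 1) / 2
      * (hadamard $ x $ a * hadamard $ x $ b * hadamard $ y $ c * hadamard $ y $ d))"
proof -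
  have r: "complex_of_real (sqrt 2) * complex_of_real (sqrt 2) = 2"
       "complex_of_real (sqrt 2) * (complex_of_real (sqrt 2) * z) = 2 * z" for z
    by (simp_all flip: of_real_mult mult.assoc)
  show ?thesis
    using cases_2[of a] cases_2[of b] cases_2[of c] cases_2[of d]
    by (elim disjE) (simp_all add: rho_def ket_bra_def bell_psi_def bell_phi_def ket_def tensor_vec_def
        axis_def hadamard_def sum_UNIV_2 scaleR_conv_of_real[where 'a=complex] r field_simps)
qed

text \<open>Distributing the product over copies across the one-copy sums turns pairs of bits into
  pairs of bit strings; the factors 1/2 multiply to the inverse of the dimension.\<close>

lemma regroup_tensor_power_rho:
  fixes r q :: "('n::finite \<Rightarrow> 2) \<times> ('n \<Rightarrow> 2)"
  shows "regroup (tensor_power (rho p)) $ r $ q =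
    (\<Sum>x\<in>UNIV. \<Sum>y\<in>UNIV. complex_of_real (dephasing (2 * p - 1) x y) / CARD('n \<Rightarrow> 2)
      * (tensor_power hadamard $ x $ fst r * tensor_power hadamard $ x $ snd r
        * tensor_power hadamard $ y $ fst q * tensor_power hadamard $ y $ snd q))"
proof -
  have "(\<Prod>k\<in>UNIV. complex_of_real (if x k = y k then 1 else 2 * p - 1) / 2) =
      complex_of_real (dephasing (2 * p - 1) x y) / CARD('n \<Rightarrow> 2)" for x y :: "'n \<Rightarrow> 2"
    by (simp add: prod_dividef dephasing_def card_fun flip: of_real_prod)
  then show ?thesis
    by (simp add: regroup_def tensor_power_def rho_hadamard prod_sum_fun prod.distrib
        del: times_divide_eq_left times_divide_eq_right)
qed

section \<open>Correlations in the Hadamard basis\<close>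

lemma sum_UNIV_prod: "(\<Sum>z\<in>UNIV. f z) = (\<Sum>a\<in>UNIV. \<Sum>b\<in>UNIV. f (a, b))"
  by (simp add: sum.cartesian_product flip: UNIV_Times_UNIV)

definition hadamard_conj :: "complex ^ ('n::finite \<Rightarrow> 2) ^ ('n \<Rightarrow> 2) \<Rightarrow> complex ^ ('n \<Rightarrow> 2) ^ ('n \<Rightarrow> 2)" where
  "hadamard_conj A = tensor_power hadamard ** A ** tensor_power hadamard"

lemma tensor_power_hadamard_sym: "tensor_power hadamard $ i $ j = tensor_power hadamard $ j $ i"
  by (simp add: tensor_power_def hadamard_sym)

lemma hadamard_conj_entry:
  "hadamard_conj A $ y $ x =
    (\<Sum>i\<in>UNIV. \<Sum>j\<in>UNIV. A $ i $ j * (tensor_power hadamard $ x $ j * tensor_power hadamard $ y $ i))"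
  unfolding hadamard_conj_def matrix_matrix_mult_def
  by (subst sum.swap) (simp add: sum_distrib_left tensor_power_hadamard_sym[of _ x] mult_ac)

lemma trace_tensor_mat_mult:
  "trace ((A \<otimes> B) ** R) =
    (\<Sum>q\<in>UNIV. \<Sum>r\<in>UNIV. A $ fst q $ fst r * B $ snd q $ snd r * R $ r $ q)"
  by (simp add: trace_def matrix_matrix_mult_def tensor_mat_def)

lemma sum_prod_separate:
  fixes f :: "'a::finite \<Rightarrow> 'a \<Rightarrow> complex" and g :: "'b::finite \<Rightarrow> 'b \<Rightarrow> complex"
  shows "(\<Sum>q\<in>UNIV. \<Sum>r\<in>UNIV. f (fst q) (fst r) * g (snd q) (snd r)) =
    (\<Sum>i\<in>UNIV. \<Sum>j\<in>UNIV. f i j) * (\<Sum>i\<in>UNIV. \<Sum>j\<in>UNIV. g i j)"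
  by (simp add: sum_UNIV_prod sum_product)

text \<open>The rotated state consists of terms |x x><y y|, and the trace of
  \<open>A \<otimes> B\<close> against such a term is the product of the two entries at
  \<open>(y, x)\<close>. In coordinates, the sums over Alice's and Bob's labels separate into these
  entries.\<close>

lemma correlation:
  fixes A B :: "complex ^ ('n::finite \<Rightarrow> 2) ^ ('n \<Rightarrow> 2)"
  shows "trace ((A \<otimes> B) ** regroup (tensor_power (rho p))) =
    (\<Sum>x\<in>UNIV. \<Sum>y\<in>UNIV. complex_of_real (dephasing (2 * p - 1) x y) / CARD('n \<Rightarrow> 2)
      * (hadamard_conj A $ y $ x * hadamard_conj B $ y $ x))"
proof -
  let ?H = "tensor_power hadamard :: complex ^ ('n \<Rightarrow> 2) ^ ('n \<Rightarrow> 2)"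
  let ?k = "\<lambda>x y. complex_of_real (dephasing (2 * p - 1) x y) / CARD('n \<Rightarrow> 2)"
  let ?t = "\<lambda>C x y i j. C $ i $ j * (?H $ x $ j * ?H $ y $ i)"
  have "trace ((A \<otimes> B) ** regroup (tensor_power (rho p))) =
      (\<Sum>q\<in>UNIV. \<Sum>r\<in>UNIV. \<Sum>x\<in>UNIV. \<Sum>y\<in>UNIV.
        ?k x y * (?t A x y (fst q) (fst r) * ?t B x y (snd q) (snd r)))"
    unfolding trace_tensor_mat_mult
    by (simp only: regroup_tensor_power_rho sum_distrib_left mult_ac)
  also have "\<dots> = (\<Sum>x\<in>UNIV. \<Sum>y\<in>UNIV. \<Sum>q\<in>UNIV. \<Sum>r\<in>UNIV.
        ?k x y * (?t A x y (fst q) (fst r) * ?t B x y (snd q) (snd r)))"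
    (is "(\<Sum>q\<in>UNIV. \<Sum>r\<in>UNIV. \<Sum>x\<in>UNIV. \<Sum>y\<in>UNIV. ?f x y q r) = _")
  proof -
    have "(\<Sum>q\<in>UNIV. \<Sum>r\<in>UNIV. \<Sum>x\<in>UNIV. \<Sum>y\<in>UNIV. ?f x y q r) =
        (\<Sum>q\<in>UNIV. \<Sum>x\<in>UNIV. \<Sum>y\<in>UNIV. \<Sum>r\<in>UNIV. ?f x y q r)"
      by (rule sum.cong[OF refl], subst sum.swap, rule sum.cong[OF refl], rule sum.swap)
    also have "\<dots> = (\<Sum>x\<in>UNIV. \<Sum>y\<in>UNIV. \<Sum>q\<in>UNIV. \<Sum>r\<in>UNIV. ?f x y q r)"
      by (subst sum.swap, rule sum.cong[OF refl], rule sum.swap)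
    finally show ?thesis .
  qed
  also have "\<dots> = (\<Sum>x\<in>UNIV. \<Sum>y\<in>UNIV. ?k x y * (hadamard_conj A $ y $ x * hadamard_conj B $ y $ x))"
    using sum_prod_separate[of "?t A x y" "?t B x y" for x y]
    by (simp only: hadamard_conj_entry flip: sum_distrib_left)
  finally show ?thesis .
qed

lemma trace_chsh_operator_mult:
  "trace (chsh_operator A0 A1 B0 B1 ** R) =
    trace ((A0 \<otimes> B0) ** R) + trace ((A0 \<otimes> B1) ** R) + trace ((A1 \<otimes> B0) ** R) - trace ((A1 \<otimes> B1) ** R)"
  by (simp add: chsh_operator_def trace_def matrix_matrix_mult_def sum.distrib sum_subtractf algebra_simps)

lemma chsh_correlation:
  fixes A0 A1 B0 B1 :: "complex ^ ('n::finite \<Rightarrow> 2) ^ ('n \<Rightarrow> 2)"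
  shows "Re (trace (chsh_operator A0 A1 B0 B1 ** regroup (tensor_power (rho p)))) =
    (\<Sum>x\<in>UNIV. \<Sum>y\<in>UNIV. dephasing (2 * p - 1) x y *
      Re (hadamard_conj A0 $ y $ x * (hadamard_conj B0 $ y $ x + hadamard_conj B1 $ y $ x)
        + hadamard_conj A1 $ y $ x * (hadamard_conj B0 $ y $ x - hadamard_conj B1 $ y $ x)))
      / CARD('n \<Rightarrow> 2)"
  unfolding trace_chsh_operator_mult correlation
  by (simp add: sum_divide_distrib flip: sum.distrib sum_subtractf)
    (intro sum.cong refl; simp add: field_simps)

section \<open>Observables under the change of basis\<close>

lemma tensor_power_hadamard_involution: "tensor_power hadamard ** tensor_power hadamard = mat 1"
  by (simp add: tensor_power_mult hadamard_involution tensor_power_mat_1)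

text \<open>This allows the optimal observables to be chosen directly in the rotated frame.\<close>

lemma hadamard_conj_involution: "hadamard_conj (hadamard_conj A) = A"
proof -
  have "hadamard_conj (hadamard_conj A) =
      (tensor_power hadamard ** tensor_power hadamard) ** A ** (tensor_power hadamard ** tensor_power hadamard)"
    by (simp add: hadamard_conj_def matrix_mul_assoc)
  then show ?thesis by (simp add: tensor_power_hadamard_involution)
qed

lemma hermitian_adjoint_mult: "hermitian_adjoint (A ** B) = hermitian_adjoint B ** hermitian_adjoint A"
  by (simp add: vec_eq_iff hermitian_adjoint_def map_matrix_def transpose_def matrix_matrix_mult_def mult.commute)

lemma hermitian_adjoint_tensor_power_hadamard:
  "hermitian_adjoint (tensor_power hadamard) = tensor_power hadamard"
  by (simp add: vec_eq_iff hermitian_adjoint_def map_matrix_def transpose_def tensor_power_def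
      hadamard_real hadamard_sym)

lemma observable_hadamard_conj:
  assumes "observable A"
  shows "observable (hadamard_conj A)"
proof -
  have "hadamard_conj A ** hadamard_conj A =
      tensor_power hadamard ** (A ** (tensor_power hadamard ** tensor_power hadamard) ** A) ** tensor_power hadamard"
    by (simp only: hadamard_conj_def matrix_mul_assoc)
  also have "\<dots> = mat 1"
    using assms by (simp add: observable_def tensor_power_hadamard_involution)
  finally have "hadamard_conj A ** hadamard_conj A = mat 1" .
  moreover have "hermitian_adjoint (hadamard_conj A) = hadamard_conj A"
    using assms
    by (simp add: observable_def hadamard_conj_def hermitian_adjoint_mult
        hermitian_adjoint_tensor_power_hadamard matrix_mul_assoc)
  ultimately show ?thesis by (simp add: observable_def)
qed

lemma observable_cnj:
  assumes "observable A"
  shows "cnj (A $ j $ i) = A $ i $ j"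
  using assms by (simp add: observable_def hermitian_adjoint_def map_matrix_def transpose_def vec_eq_iff)

text \<open>Read off the diagonal entry of \<open>A ** A = mat 1\<close> at \<open>x\<close>, where
  hermiticity makes each product a squared modulus.\<close>

lemma observable_column_sum:
  assumes "observable A"
  shows "(\<Sum>y\<in>UNIV. (norm (A $ y $ x))\<^sup>2) = 1"
proof -
  have "(\<Sum>y\<in>UNIV. A $ x $ y * A $ y $ x) = 1"
    using assms by (simp add: observable_def matrix_matrix_mult_def mat_def vec_eq_iff)
  moreover have "A $ x $ y * A $ y $ x = complex_of_real ((norm (A $ y $ x))\<^sup>2)" for y
    using observable_cnj[OF assms, of y x] by (metis complex_norm_square mult.commute)
  ultimately have "complex_of_real (\<Sum>y\<in>UNIV. (norm (A $ y $ x))\<^sup>2) = 1" by simp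
  then show ?thesis by (simp only: of_real_eq_1_iff)
qed

section \<open>The upper bound for any number of copies\<close>

lemma dephasing_refl: "dephasing s x x = 1"
  by (simp add: dephasing_def)

text \<open>A position where the strings differ contributes one factor \<open>s\<close>; all other
  factors have modulus at most 1.\<close>

lemma abs_dephasing_le:
  assumes "\<bar>s\<bar> \<le> 1" "y \<noteq> x"
  shows "\<bar>dephasing s x y\<bar> \<le> \<bar>s\<bar>"
proof -
  obtain k where k: "x k \<noteq> y k" using assms(2) by (metis ext)
  have "\<bar>\<Prod>l\<in>UNIV-{k}. if x l = y l then 1 else s\<bar> \<le> 1"
    unfolding abs_prod using assms(1) by (intro prod_le_1) auto
  then show ?thesis
    using k by (simp add: dephasing_def prod.remove[of UNIV k] abs_mult mult_left_le)
qed

lemma chsh_le: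
  fixes A0 A1 B0 B1 :: "complex ^ ('n::finite \<Rightarrow> 2) ^ ('n \<Rightarrow> 2)"
  assumes "p \<in> {0..1}" and obs: "observable A0" "observable A1" "observable B0" "observable B1"
  shows "Re (trace (chsh_operator A0 A1 B0 B1 ** regroup (tensor_power (rho p))))
    \<le> 2 * sqrt (1 + (2 * p - 1)\<^sup>2)"
proof -
  let ?s = "2 * p - 1"
  let ?h = hadamard_conj
  have s: "\<bar>?s\<bar> \<le> 1" using assms(1) by (auto simp: abs_le_iff)
  have "(\<Sum>y\<in>UNIV. dephasing ?s x y *
      Re (?h A0 $ y $ x * (?h B0 $ y $ x + ?h B1 $ y $ x) + ?h A1 $ y $ x * (?h B0 $ y $ x - ?h B1 $ y $ x)))
      \<le> 2 * sqrt (1 + ?s\<^sup>2)" for x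
  proof -
    define u where "u A = (\<chi> y. ?h A $ y $ x)" for A
    \<comment> \<open>The conjugate turns the bilinear \<open>A\<^sub>y\<^sub>x B\<^sub>y\<^sub>x\<close> into a real inner product.\<close>
    define v where "v B = (\<chi> y. cnj (?h B $ y $ x))" for B
    have unit: "norm (u A) = 1" "norm (v A) = 1" if "observable A" for A
      using observable_column_sum[OF observable_hadamard_conj[OF that], of x]
      by (simp_all add: u_def v_def norm_vec_def L2_set_def)
    \<comment> \<open>Diagonal entries of a Hermitian matrix are real.\<close>
    have real: "Im (v A $ x) = 0" if "observable A" for A
      using observable_cnj[OF observable_hadamard_conj[OF that], of x x]
      by (simp add: v_def complex_eq_iff)
    have "(\<Sum>y\<in>UNIV. dephasing ?s x y *
        (u A0 $ y \<bullet> (v B0 + v B1) $ y + u A1 $ y \<bullet> (v B0 - v B1) $ y)) \<le> 2 * sqrt (1 + ?s\<^sup>2)"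
      by (rule sum_Horodecki_le[where x = x])
        (use unit real obs s in \<open>auto simp: dephasing_refl abs_dephasing_le\<close>)
    then show ?thesis by (simp add: u_def v_def inner_complex_def algebra_simps)
  qed
  \<comment> \<open>The bound holds for each \<open>x\<close>, so it survives the average over all
    bit strings.\<close>
  then have "(\<Sum>x\<in>(UNIV :: ('n \<Rightarrow> 2) set). \<Sum>y\<in>UNIV. dephasing ?s x y *
      Re (?h A0 $ y $ x * (?h B0 $ y $ x + ?h B1 $ y $ x) + ?h A1 $ y $ x * (?h B0 $ y $ x - ?h B1 $ y $ x)))
      \<le> real CARD('n \<Rightarrow> 2) * (2 * sqrt (1 + ?s\<^sup>2))"
    by (intro sum_bounded_above) auto
  then show ?thesis
    unfolding chsh_correlation by (subst pos_divide_le_eq) (simp_all add: mult.commute)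
qed

section \<open>Pauli observables attaining the bound\<close>

text \<open>Addition in the type \<open>2\<close> is modulo 2, so adding 1 negates the bit.\<close>

definition flip :: "'n \<Rightarrow> ('n \<Rightarrow> 2) \<Rightarrow> 'n \<Rightarrow> 2" where
  "flip k x = x(k := x k + 1)"

text \<open>The Pauli matrix on copy \<open>k\<close>, tensored with the identity on all other
  copies.\<close>

definition pauli_X :: "'n::finite \<Rightarrow> complex ^ ('n \<Rightarrow> 2) ^ ('n \<Rightarrow> 2)" where
  "pauli_X k = (\<chi> i j. if i = flip k j then 1 else 0)"

definition pauli_Z :: "'n::finite \<Rightarrow> complex ^ ('n \<Rightarrow> 2) ^ ('n \<Rightarrow> 2)" where
  "pauli_Z k = (\<chi> i j. if i = j then (if i k = 0 then 1 else -1) else 0)"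

lemma flip_flip: "flip k (flip k x) = x"
  using cases_2[of "x k"] by (auto simp: flip_def fun_eq_iff)

lemma flip_eq_iff: "x = flip k y \<longleftrightarrow> y = flip k x"
  by (metis flip_flip)

lemma flip_apply_eq_0: "flip k x k = 0 \<longleftrightarrow> x k \<noteq> 0"
  using cases_2[of "x k"] by (auto simp: flip_def)

lemma flip_neq: "flip k x \<noteq> x"
  using flip_apply_eq_0[of k x] by metis

lemma observable_pauli_X: "observable (pauli_X k)"
  by (auto simp: observable_def pauli_X_def hermitian_adjoint_def map_matrix_def transpose_def
      vec_eq_iff matrix_matrix_mult_def mat_def mult_delta_right flip_flip)

lemma observable_pauli_Z: "observable (pauli_Z k)"
  by (auto simp: observable_def pauli_Z_def hermitian_adjoint_def map_matrix_def transpose_def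
      vec_eq_iff matrix_matrix_mult_def mat_def mult_delta_right)

lemma pauli_anticommute: "pauli_X k ** pauli_Z k = - (pauli_Z k ** pauli_X k)"
  by (auto simp: pauli_X_def pauli_Z_def vec_eq_iff matrix_matrix_mult_def flip_apply_eq_0 mult_delta_right)

text \<open>The cross terms of the square cancel, leaving \<open>a\<^sup>2 + b\<^sup>2\<close> times
  the identity; real coefficients preserve hermiticity.\<close>

lemma observable_anticommuting_combination:
  assumes obs: "observable P" "observable Q" and anti: "P ** Q = - (Q ** P)" and ab: "a\<^sup>2 + b\<^sup>2 = 1"
  shows "observable (a *\<^sub>R P + b *\<^sub>R Q)"
proof -
  have "(a *\<^sub>R P + b *\<^sub>R Q) ** (a *\<^sub>R P + b *\<^sub>R Q) =
      a\<^sup>2 *\<^sub>R (P ** P) + b\<^sup>2 *\<^sub>R (Q ** Q) + (a * b) *\<^sub>R (P ** Q + Q ** P)"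
    by (simp add: vec_eq_iff matrix_matrix_mult_def scaleR_sum_right algebra_simps power2_eq_square
        flip: sum.distrib)
  also have "\<dots> = mat 1"
    using obs anti ab by (simp add: observable_def flip: scaleR_add_left)
  finally have "(a *\<^sub>R P + b *\<^sub>R Q) ** (a *\<^sub>R P + b *\<^sub>R Q) = mat 1" .
  moreover have "hermitian_adjoint (a *\<^sub>R P + b *\<^sub>R Q) = a *\<^sub>R hermitian_adjoint P + b *\<^sub>R hermitian_adjoint Q"
    by (simp add: vec_eq_iff hermitian_adjoint_def map_matrix_def transpose_def)
  ultimately show ?thesis using obs by (simp add: observable_def)
qed

lemma dephasing_flip: "dephasing s x (flip k x) = s"
  by (simp add: dephasing_def prod.remove[of UNIV k] flip_def)

lemma chsh_attained:
  obtains A0 A1 B0 B1 :: "complex ^ ('n::finite \<Rightarrow> 2) ^ ('n \<Rightarrow> 2)"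
  where "observable A0" "observable A1" "observable B0" "observable B1"
    and "Re (trace (chsh_operator A0 A1 B0 B1 ** regroup (tensor_power (rho p)))) =
      2 * sqrt (1 + (2 * p - 1)\<^sup>2)"
proof -
  \<comment> \<open>Any one copy serves; the others are left alone.\<close>
  fix k :: 'n
  define s where "s = 2 * p - 1"
  define r where "r = sqrt (1 + s\<^sup>2)"
  have r: "r > 0" "r\<^sup>2 = 1 + s\<^sup>2" by (simp_all add: r_def add_pos_nonneg)
  let ?X = "pauli_X k" and ?Z = "pauli_Z k"
  \<comment> \<open>In the rotated frame Z has correlation 1 and X has correlation \<open>s\<close>.
    With Alice measuring Z and X, Bob's best choices are the normalized \<open>Z + s X\<close> and
    \<open>Z - s X\<close>.\<close>
  define B where "B b = (1 / r) *\<^sub>R ?Z + (b * s / r) *\<^sub>R ?X" for b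
  have anti: "?Z ** ?X = - (?X ** ?Z)" by (simp add: pauli_anticommute)
  have B: "observable (B b)" if "b\<^sup>2 = 1" for b
    unfolding B_def
  proof (rule observable_anticommuting_combination[OF observable_pauli_Z observable_pauli_X anti])
    have "(1 / r)\<^sup>2 + (b * s / r)\<^sup>2 = (1 + s\<^sup>2) / r\<^sup>2"
      using that by (simp add: power_divide power_mult_distrib add_divide_distrib)
    then show "(1 / r)\<^sup>2 + (b * s / r)\<^sup>2 = 1"
      using r(1) by (simp flip: r(2))
  qed
  \<comment> \<open>Only two entries of column \<open>x\<close> matter: \<open>y = x\<close>,
    through Z with weight 1, and \<open>y = flip k x\<close>, through X with weight
    \<open>s\<close>.\<close>
  have row: "(\<Sum>y\<in>UNIV. dephasing s x y *
      Re (?Z $ y $ x * (B 1 $ y $ x + B (-1) $ y $ x) + ?X $ y $ x * (B 1 $ y $ x - B (-1) $ y $ x))) = 2 * r" for x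
  proof -
    have "(\<Sum>y\<in>UNIV. dephasing s x y *
        Re (?Z $ y $ x * (B 1 $ y $ x + B (-1) $ y $ x) + ?X $ y $ x * (B 1 $ y $ x - B (-1) $ y $ x))) =
      (\<Sum>y\<in>UNIV. (if y = x then 2 / r else 0) + (if y = flip k x then 2 * s * s / r else 0))"
      by (intro sum.cong refl)
        (auto simp: B_def pauli_X_def pauli_Z_def dephasing_refl dephasing_flip flip_neq flip_neq[symmetric])
    also have "\<dots> = 2 / r + 2 * s * s / r" by (simp add: sum.distrib)
    also have "\<dots> = 2 * r\<^sup>2 / r" unfolding r(2) by (simp add: power2_eq_square field_simps add_divide_distrib)
    also have "\<dots> = 2 * r" by (simp add: power2_eq_square)
    finally show ?thesis .
  qed
  show ?thesis
  proof (rule that)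
    show "Re (trace (chsh_operator (hadamard_conj ?Z) (hadamard_conj ?X) (hadamard_conj (B 1)) (hadamard_conj (B (-1)))
        ** regroup (tensor_power (rho p)))) = 2 * sqrt (1 + (2 * p - 1)\<^sup>2)"
      unfolding chsh_correlation hadamard_conj_involution s_def[symmetric] row
      by (simp add: r_def s_def)
  qed (simp_all add: observable_hadamard_conj B observable_pauli_X observable_pauli_Z)
qed

text \<open>The bound and its attainment do not depend on the number of copies, so the supremum is a
  maximum with the same value for every \<open>'n\<close>.\<close>

theorem chsh_value_eq:
  assumes "p \<in> {0..1}"
  shows "chsh_value TYPE('n::finite) p = 2 * sqrt (1 + (1 - 2 * p)\<^sup>2)"
proof -
  have "chsh_value TYPE('n) p = 2 * sqrt (1 + (2 * p - 1)\<^sup>2)"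
    unfolding chsh_value_def
  proof (rule cSup_eq_maximum, goal_cases)
    case 1
    obtain A0 A1 B0 B1 :: "complex ^ ('n \<Rightarrow> 2) ^ ('n \<Rightarrow> 2)"
      where "observable A0" "observable A1" "observable B0" "observable B1"
        and "2 * sqrt (1 + (2 * p - 1)\<^sup>2) =
          Re (trace (chsh_operator A0 A1 B0 B1 ** regroup (tensor_power (rho p))))"
      by (metis chsh_attained)
    then show ?case by blast
  next
    case (2 v)
    then show ?case using chsh_le[OF assms] by blast
  qed
  then show ?thesis by (simp add: power2_commute)
qed

theorem mainTheorem3:
  fixes p :: real
  assumes "p \<in> {0..1}"
  shows "chsh_value TYPE(1) p = chsh_value TYPE(2) p
       \<and> chsh_value TYPE(2) p = 2 * sqrt (1 + (1 - 2 * p)\<^sup>2)"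
  using assms by (simp add: chsh_value_eq)

end
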